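(* We have $$\sum_{k=1}^\infty \frac{64^{k} \left( (368 k^3-396 k^2+116 k-9)\, \mathcal{H}(k) + \frac{240 k^3-252 k^2+12 k+11}{2k-1} \right)}{k^{2}(2k-1)(4k-1)(4k-3)\binom{3k}{k}\binom{6k}{3k}} = 4 \pi^3,$$ where $\mathcal{H}(k) = 2 H_{6k-1} - H_{3k-1} + H_{2k-1} - H_{k-1}$.
   Context: For $n\in\{0,1,2,\ldots\}$, $H_n=\sum_{0<j\le n}\frac1j$ denotes the usual harmonic number (so $H_0=0$). *)

theory Defs
  imports "HOL-Analysis.Analysis"
begin

text \<open>The indices use truncated subtraction on \<^typ>\<open>nat\<close>, which agrees with ordinary
  subtraction for \<open>k \<ge> 1\<close>, the only values that occur.\<close>

definition calH :: "nat \<Rightarrow> real" where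
  "calH k = 2 * harm (6 * k - 1) - harm (3 * k - 1) + harm (2 * k - 1) - harm (k - 1)"

end

theory Submission
  imports Defs "HOL-Real_Asymp.Real_Asymp"
begin

text \<open>
  The series is an accelerated form of
  \<open>\<Sum>\<^sub>k (-1)\<^sup>k 4 / (k + 1/2)\<^sup>3 = \<pi>\<^sup>3\<close>, obtained from a Wilf-Zeilberger pair that carries
  a parameter \<open>s\<close>; the harmonic numbers appear because the pair is differentiated at \<open>s = 0\<close>.

  Start from the alternating well-poised series with terms
  \<open>(-1)\<^sup>k (a + 2k) \<Gamma>(b+k) \<Gamma>(c+k) \<Gamma>(d+k) / (\<Gamma>(1+a-b+k) \<Gamma>(1+a-c+k) \<Gamma>(1+a-d+k))\<close>
  and restrict it to the parameters
  \<open>(a, b, c, d) = (1 + 2s + 3n, 1/2 + 2n, 1/2 + 2s + n, 1/2 + s)\<close>. With \<open>y = k + 1/2\<close>, with the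
  normalising factor \<open>\<Gamma>(1+a-b-d) \<Gamma>(1+a-c-d)\<close>, and without the sign \<open>(-1)\<^sup>k\<close>, the term becomes

  \<open>F\<^sub>s(n, y) = \<Gamma>(1+s+n) \<Gamma>(1-s+2n) / (y+s)\<^bsub>3n+1\<^esub> * (1 / (y+2n) + 1 / (y+n+2s))\<close>,

  where \<open>(z)\<^bsub>m\<^esub>\<close> is the Pochhammer symbol. It has the companion

  \<open>G\<^sub>s(n, y) = \<Gamma>(1+s+n) \<Gamma>(1-s+2n) / (y+s)\<^bsub>3n+3\<^esub> * Q\<^sub>s(n, y) / ((y+2n) (y+2n+1) (y+n+2s))\<close>,

  where \<open>Q\<^sub>s(n, y)\<close> is a polynomial of total degree four in \<open>s\<close>, \<open>n\<close>, \<open>y\<close>, and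
  \<open>F\<^sub>s(n, y) - F\<^sub>s(n+1, y) = G\<^sub>s(n, y) + G\<^sub>s(n, y+1)\<close>. The direction of \<open>s\<close> is chosen so
  that the logarithmic derivative of the hypergeometric factor of \<open>G\<^sub>s(n, 1/2)\<close> at \<open>s = 0\<close> is the
  combination \<open>- \<H>(n+1)\<close> of harmonic numbers, up to the rational term \<open>1 / (2n+1)\<close>.

  The proof works with the derivatives \<open>F'\<close> and \<open>G'\<close> at \<open>s = 0\<close>, which satisfy the same
  difference equation (\<open>WZ_pair\<close>). Multiplying it by \<open>(-1)\<^sup>k\<close> and summing over \<open>k\<close> makes the
  right-hand side telescope to \<open>G'(n, 1/2)\<close>; summing over \<open>n\<close> then makes the left-hand side
  telescope to \<open>\<Sum>\<^sub>k (-1)\<^sup>k F'(0, k + 1/2)\<close>, because \<open>F'(n, y)\<close> is \<open>O(n / 3\<^sup>n)\<close>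
  (\<open>abs_F'_le\<close>). Since \<open>F'(0, y) = - 4 / y\<^sup>3\<close>, the result is
  \<open>\<Sum>\<^sub>n G'(n, 1/2) = - \<pi>\<^sup>3\<close> (\<open>G'_half_sums\<close>), and the summand with index \<open>k = n + 1\<close> of the
  theorem is \<open>- 4 G'(n, 1/2)\<close>. The value of the alternating sum of reciprocal cubes follows from
  the reflection formula of the Gamma function, whose logarithm is differentiated three times.
\<close>

section \<open>The differentiated Wilf-Zeilberger pair\<close>

text \<open>The value at \<open>s = 0\<close> of \<open>\<Gamma>(1+s+n) \<Gamma>(1-s+2n) / (y+s)\<^bsub>m\<^esub>\<close>; the next
  definition is its logarithmic derivative there.\<close>

definition weight :: "nat \<Rightarrow> nat \<Rightarrow> real \<Rightarrow> real" where
  "weight n m y = fact n * fact (2 * n) / pochhammer y m"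

definition dlog_weight :: "nat \<Rightarrow> nat \<Rightarrow> real \<Rightarrow> real" where
  "dlog_weight n m y = harm n - harm (2 * n) - (\<Sum>j<m. 1 / (y + real j))"

text \<open>The derivative of \<open>F\<^sub>s(n, y)\<close> at \<open>s = 0\<close>. The last summand comes from the only other
  place where \<open>s\<close> occurs, the fraction \<open>1 / (y+n+2s)\<close>.\<close>

definition F' :: "nat \<Rightarrow> real \<Rightarrow> real" where
  "F' n y = weight n (3 * n + 1) y *
     ((1 / (y + 2 * real n) + 1 / (y + real n)) * dlog_weight n (3 * n + 1) y
      - 2 / (y + real n)\<^sup>2)"

text \<open>The expansion of the numerator of \<open>G\<^sub>s(n, y)\<close> is
  \<open>Q\<^sub>s(n, y) = Q\<^sub>0 n y + s Q\<^sub>1 n y + O(s\<^sup>2)\<close>. The coefficients come from solving the linear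
  system that the difference equation imposes on a numerator of degree four.\<close>

definition Q\<^sub>0 :: "real \<Rightarrow> real \<Rightarrow> real" where
  "Q\<^sub>0 x y = y ^ 4 + (11 * x + 5) * y ^ 3 + (45 * x\<^sup>2 + 41 * x + 9) * y\<^sup>2
     + (77 * x ^ 3 + 99 * x\<^sup>2 + 38 * x + 4) * y + (46 * x ^ 4 + 73 * x ^ 3 + 37 * x\<^sup>2 + 6 * x)"

definition Q\<^sub>1 :: "real \<Rightarrow> real \<Rightarrow> real" where
  "Q\<^sub>1 x y = 3 * y ^ 3 + (24 * x + 11) * y\<^sup>2 + (63 * x\<^sup>2 + 58 * x + 14) * y
     + (54 * x ^ 3 + 72 * x\<^sup>2 + 31 * x + 4)"

text \<open>The value and the derivative at \<open>s = 0\<close> of the rational factor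
  \<open>Q\<^sub>s(n, y) / ((y+2n) (y+2n+1) (y+n+2s))\<close>.\<close>

definition R\<^sub>0 :: "real \<Rightarrow> real \<Rightarrow> real" where
  "R\<^sub>0 x y = Q\<^sub>0 x y / ((y + 2 * x) * (y + 2 * x + 1) * (y + x))"

definition R\<^sub>1 :: "real \<Rightarrow> real \<Rightarrow> real" where
  "R\<^sub>1 x y = (Q\<^sub>1 x y - 2 * Q\<^sub>0 x y / (y + x)) / ((y + 2 * x) * (y + 2 * x + 1) * (y + x))"

text \<open>The derivative of \<open>G\<^sub>s(n, y)\<close> at \<open>s = 0\<close>.\<close>

definition G' :: "nat \<Rightarrow> real \<Rightarrow> real" where
  "G' n y = weight n (3 * n + 3) y * (R\<^sub>0 (real n) y * dlog_weight n (3 * n + 3) y + R\<^sub>1 (real n) y)"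

text \<open>Dividing the difference equation of \<open>F\<^sub>s\<close> and \<open>G\<^sub>s\<close> by the common factor
  \<open>\<Gamma>(1+s+n) \<Gamma>(1-s+2n) / (y+s)\<^bsub>3n+3\<^esub>\<close> leaves an identity of rational functions in \<open>s\<close>,
  \<open>n\<close> (here the real \<open>x\<close>) and \<open>y\<close>. The next two lemmas are its coefficients of \<open>s\<^sup>0\<close> and
  \<open>s\<^sup>1\<close>. In the second, the sums and differences of reciprocals are the logarithmic
  derivatives of the factors in front of the fractions of the first.\<close>

lemma certificate_order_0:
  fixes x y :: real
  assumes "x \<ge> 0" "y > 0"
  shows "(y + 3*x + 1) * (y + 3*x + 2) * (1 / (y + 2*x) + 1 / (y + x))
           - (x + 1) * (2*x + 1) * (2*x + 2) / (y + 3*x + 3) * (1 / (y + 2*x + 2) + 1 / (y + x + 1))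
         = R\<^sub>0 x y + y / (y + 3*x + 3) * R\<^sub>0 x (y + 1)"
proof -
  have "y + 3*x + 3 > 0" "y + 2*x > 0" "y + 2*x + 1 > 0" "y + 2*x + 2 > 0" "y + x > 0" "y + x + 1 > 0"
    using assms by auto
  moreover have "y + 1 + 2*x = y + 2*x + 1" "y + 1 + x = y + x + 1" "y + 2*x + 1 + 1 = y + 2*x + 2"
    by auto
  ultimately show ?thesis
    unfolding R\<^sub>0_def Q\<^sub>0_def by (simp add: divide_simps) algebra
qed

lemma certificate_order_1:
  fixes x y :: real
  assumes "x \<ge> 0" "y > 0"
  shows "(y + 3*x + 1) * (y + 3*x + 2) * ((1 / (y + 2*x) + 1 / (y + x))
             * (1 / (y + 3*x + 1) + 1 / (y + 3*x + 2)) - 2 / (y + x)\<^sup>2)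
           - (x + 1) * (2*x + 1) * (2*x + 2) / (y + 3*x + 3) * ((1 / (y + 2*x + 2) + 1 / (y + x + 1))
             * (1 / (x + 1) - 1 / (2*x + 1) - 1 / (2*x + 2) - 1 / (y + 3*x + 3)) - 2 / (y + x + 1)\<^sup>2)
         = R\<^sub>1 x y
           + y / (y + 3*x + 3) * (R\<^sub>0 x (y + 1) * (1 / y - 1 / (y + 3*x + 3)) + R\<^sub>1 x (y + 1))"
proof -
  have "y + 3*x + 3 > 0" "y + 2*x > 0" "y + 2*x + 1 > 0" "y + 2*x + 2 > 0" "y + x > 0" "y + x + 1 > 0"
    "x + 1 > 0" "2*x + 1 > 0" "2*x + 2 > 0" "y + 3*x + 1 > 0" "y + 3*x + 2 > 0"
    using assms by auto
  moreover have "y + 1 + 2*x = y + 2*x + 1" "y + 1 + x = y + x + 1" "y + 2*x + 1 + 1 = y + 2*x + 2"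
    by auto
  ultimately show ?thesis
    using assms unfolding R\<^sub>0_def R\<^sub>1_def Q\<^sub>0_def Q\<^sub>1_def by (simp add: divide_simps) algebra
qed

text \<open>Written over the common weight \<open>c\<close> with logarithmic derivative \<open>h\<close>, both sides have the form
  \<open>c * h * A + c * B\<close> with rational \<open>A\<close> and \<open>B\<close>; the parts with \<open>h\<close> agree by the order zero
  certificate and the parts without \<open>h\<close> by the order one certificate.\<close>

lemma WZ_pair:
  assumes "y > 0"
  shows "F' n y - F' (Suc n) y = G' n y + G' n (y + 1)"
proof -
  define x where "x = real n"
  define c where "c = weight n (3 * n + 3) y"
  define h where "h = dlog_weight n (3 * n + 3) y"
  have x: "x \<ge> 0" by (simp add: x_def)
  have pos: "y + 3*x + 1 > 0" "y + 3*x + 2 > 0" "y + 3*x + 3 > 0" using x assms by auto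
  have poch: "pochhammer y m > 0" for m using assms by (rule pochhammer_pos)
  have w1: "weight n (3 * n + 1) y = c * ((y + 3*x + 1) * (y + 3*x + 2))"
  proof -
    have "pochhammer y (3 * n + 3) = pochhammer y (3 * n + 1) * ((y + 3*x + 1) * (y + 3*x + 2))"
      by (simp add: numeral_eq_Suc pochhammer_Suc x_def algebra_simps)
    thus ?thesis unfolding c_def weight_def using pos poch[of "3 * n + 1"] by simp
  qed
  have h1: "dlog_weight n (3 * n + 1) y = h + (1 / (y + 3*x + 1) + 1 / (y + 3*x + 2))"
    by (simp add: h_def dlog_weight_def numeral_eq_Suc x_def add_ac)
  have w2: "weight (Suc n) (3 * Suc n + 1) y = c * ((x + 1) * (2*x + 1) * (2*x + 2) / (y + 3*x + 3))"
  proof -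
    have "pochhammer y (3 * Suc n + 1) = pochhammer y (3 * n + 3) * (y + 3*x + 3)"
      by (simp add: numeral_eq_Suc pochhammer_Suc x_def add_ac)
    moreover have "fact (2 * Suc n) = (2*x + 2) * (2*x + 1) * (fact (2 * n) :: real)"
      by (simp add: x_def algebra_simps)
    moreover have "fact (Suc n) = (x + 1) * (fact n :: real)" by (simp add: x_def algebra_simps)
    ultimately show ?thesis unfolding c_def weight_def
      by (simp only: times_divide_times_eq) (simp only: mult_ac)
  qed
  have h2: "dlog_weight (Suc n) (3 * Suc n + 1) y
              = h + (1 / (x + 1) - 1 / (2*x + 1) - 1 / (2*x + 2) - 1 / (y + 3*x + 3))"
    by (simp add: h_def dlog_weight_def numeral_eq_Suc x_def harm_Suc add_ac inverse_eq_divide)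
  have w3: "weight n (3 * n + 3) (y + 1) = c * (y / (y + 3*x + 3))"
  proof -
    have "y * pochhammer (y + 1) (3 * n + 3) = pochhammer y (3 * n + 3) * (y + 3*x + 3)"
      using pochhammer_rec[of y "3 * n + 3"] pochhammer_Suc[of y "3 * n + 3"]
      by (simp add: x_def add_ac)
    moreover have "N / pochhammer (y + 1) m = N * y / (y * pochhammer (y + 1) m)" for N m
      using assms by simp
    ultimately show ?thesis unfolding c_def weight_def by (simp only: times_divide_times_eq)
  qed
  have h3: "dlog_weight n (3 * n + 3) (y + 1) = h + (1 / y - 1 / (y + 3*x + 3))"
  proof -
    have "(\<Sum>j<Suc m. 1 / (y + real j)) = 1 / y + (\<Sum>j<m. 1 / (y + 1 + real j))" for m
      by (subst sum.lessThan_Suc_shift) (simp add: add_ac)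
    hence "1 / y + (\<Sum>j<m. 1 / (y + 1 + real j)) = (\<Sum>j<m. 1 / (y + real j)) + 1 / (y + real m)" for m
      by (metis sum.lessThan_Suc)
    from this[of "3 * n + 3"]
    have "1 / y + (\<Sum>j<3 * n + 3. 1 / (y + 1 + real j))
        = (\<Sum>j<3 * n + 3. 1 / (y + real j)) + 1 / (y + 3*x + 3)"
      by (simp only: x_def of_nat_add of_nat_mult of_nat_numeral add.assoc)
    thus ?thesis unfolding h_def dlog_weight_def by linarith
  qed
  let ?A = "(y + 3*x + 1) * (y + 3*x + 2)"
  let ?B = "(x + 1) * (2*x + 1) * (2*x + 2) / (y + 3*x + 3)"
  let ?a = "1 / (y + 2*x) + 1 / (y + x)" and ?b = "1 / (y + 2*x + 2) + 1 / (y + x + 1)"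
  let ?u = "1 / (y + 3*x + 1) + 1 / (y + 3*x + 2)"
  let ?v = "1 / (x + 1) - 1 / (2*x + 1) - 1 / (2*x + 2) - 1 / (y + 3*x + 3)"
  let ?w = "1 / y - 1 / (y + 3*x + 3)" and ?C = "y / (y + 3*x + 3)"
  have shifts: "y + 2 * real (Suc n) = y + 2*x + 2" "y + real (Suc n) = y + x + 1"
    by (simp_all add: x_def)
  have collect: "c * A * (a * (h + u) - e) - c * B * (b * (h + v) - f)
      = c * h * (A * a - B * b) + c * (A * (a * u - e) - B * (b * v - f))"
    for A B a b e f u v by (simp add: algebra_simps)
  have distribute: "c * h * (r + C * r') + c * (s + C * (r' * w + s'))
      = c * (r * h + s) + c * C * (r' * (h + w) + s')"
    for C r r' s s' w by (simp add: algebra_simps)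
  have "F' n y - F' (Suc n) y
      = c * ?A * (?a * (h + ?u) - 2 / (y + x)\<^sup>2) - c * ?B * (?b * (h + ?v) - 2 / (y + x + 1)\<^sup>2)"
    unfolding F'_def w1 h1 w2 h2 shifts x_def[symmetric] by simp
  also have "\<dots> = c * h * (?A * ?a - ?B * ?b)
      + c * (?A * (?a * ?u - 2 / (y + x)\<^sup>2) - ?B * (?b * ?v - 2 / (y + x + 1)\<^sup>2))"
    by (rule collect)
  also have "\<dots> = c * h * (R\<^sub>0 x y + ?C * R\<^sub>0 x (y + 1))
      + c * (R\<^sub>1 x y + ?C * (R\<^sub>0 x (y + 1) * ?w + R\<^sub>1 x (y + 1)))"
    by (simp only: certificate_order_0[OF x assms] certificate_order_1[OF x assms])
  also have "\<dots> = c * (R\<^sub>0 x y * h + R\<^sub>1 x y) + c * ?C * (R\<^sub>0 x (y + 1) * (h + ?w) + R\<^sub>1 x (y + 1))"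
    by (rule distribute)
  also have "\<dots> = G' n y + G' n (y + 1)"
    unfolding G'_def w3 h3 x_def[symmetric] by (simp only: c_def h_def)
  finally show ?thesis .
qed

section \<open>Growth estimates\<close>

lemma harm_le_self: "harm n \<le> real n"
proof -
  have "harm n \<le> (\<Sum>k=1..n. 1 :: real)"
    unfolding harm_def by (intro sum_mono) (simp add: inverse_eq_divide)
  thus ?thesis by simp
qed

text \<open>A crude linear bound is enough, since it is multiplied by an exponentially small or a
  cubically decaying weight.\<close>

lemma abs_dlog_weight_le:
  assumes "y \<ge> 1 / 2"
  shows "\<bar>dlog_weight n m y\<bar> \<le> 3 * real n + 2 * real m"
proof -
  have s: "(\<Sum>j<m. 1 / (y + real j)) \<le> (\<Sum>j<m. 2)"
    using assms by (intro sum_mono) (simp add: field_simps)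
  have s0: "(\<Sum>j<m. 1 / (y + real j)) \<ge> 0"
    using assms by (intro sum_nonneg) simp
  have "harm n \<ge> (0::real)" "harm (2 * n) \<ge> (0::real)" by (simp_all add: harm_nonneg)
  with s s0 harm_le_self[of n] harm_le_self[of "2 * n"] show ?thesis
    unfolding dlog_weight_def by simp
qed

lemma pochhammer_ge_fact:
  fixes x :: real
  assumes "x \<ge> 1"
  shows "pochhammer x m \<ge> fact m"
proof (induction m)
  case (Suc m)
  have "fact (Suc m) = fact m * (1 + real m)" by (simp add: algebra_simps)
  also have "\<dots> \<le> pochhammer x m * (x + real m)"
    using Suc assms by (intro mult_mono) (auto simp: pochhammer_nonneg)
  finally show ?case by (simp add: pochhammer_Suc)
qed simp

text \<open>This is \<open>binom(3n, n) \<ge> 3\<^sup>n\<close>, the source of the geometric decay in \<open>n\<close>.\<close>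

lemma fact_fact_double_le: "3 ^ n * (fact n * fact (2 * n)) \<le> (fact (3 * n) :: real)"
proof -
  have "(real (3 * n) / real n) ^ n \<le> real (3 * n choose n)"
    by (rule binomial_ge_n_over_k_pow_k) simp
  hence "3 ^ n \<le> real (3 * n choose n)" by (cases "n = 0") auto
  hence "3 ^ n * (fact n * fact (2 * n)) \<le> real (3 * n choose n) * (fact n * fact (2 * n))"
    by (intro mult_right_mono) auto
  also have "\<dots> = fact (3 * n)"
    using binomial_fact_lemma[of n "3 * n"]
    by (metis (no_types, lifting) diff_mult_distrib add_diff_cancel_left' le_add1 mult.commute
        mult_2 numeral_3_eq_3 mult_Suc of_nat_fact of_nat_mult numeral_2_eq_2)
  finally show ?thesis .
qed

lemma weight_nonneg:
  assumes "y > 0"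
  shows "weight n m y \<ge> 0"
  unfolding weight_def using assms by (intro divide_nonneg_pos pochhammer_pos) auto

lemma weight_le:
  assumes "y > 0"
  shows "weight n (3 * n + 1) y \<le> 1 / (3 ^ n * y)"
proof -
  have "3 ^ n * (fact n * fact (2 * n)) \<le> pochhammer (y + 1) (3 * n)"
    using fact_fact_double_le[of n] pochhammer_ge_fact[of "y + 1" "3 * n"] assms by simp
  moreover have "pochhammer y (3 * n + 1) = y * pochhammer (y + 1) (3 * n)"
    by (simp add: pochhammer_rec)
  moreover have "pochhammer (y + 1) (3 * n) > 0" using assms by (intro pochhammer_pos) simp
  ultimately show ?thesis unfolding weight_def using assms by (simp add: field_simps)
qed

text \<open>The bound separates into a null sequence in \<open>n\<close> and a factor that is summable over
  \<open>y = k + 1/2\<close>. It therefore gives both the convergence of the sums over \<open>k\<close> and their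
  decay in \<open>n\<close>.\<close>

lemma abs_F'_le:
  assumes "y \<ge> 1 / 2"
  shows "\<bar>F' n y\<bar> \<le> (18 * real n + 8) / 3 ^ n * inverse (y\<^sup>2)"
proof -
  have y: "y > 0" using assms by simp
  let ?w = "weight n (3 * n + 1) y"
  let ?h = "dlog_weight n (3 * n + 1) y"
  let ?a = "1 / (y + 2 * real n) + 1 / (y + real n)"
  have "1 / (y + 2 * real n) \<le> 1 / y" "1 / (y + real n) \<le> 1 / y"
    using y by (auto intro!: divide_left_mono)
  hence a: "?a \<le> 2 / y" by simp
  have a0: "?a \<ge> 0" using y by simp
  have h: "\<bar>?h\<bar> \<le> 9 * real n + 2" using abs_dlog_weight_le[OF assms, of n "3 * n + 1"] by simp
  have "2 / (y + real n)\<^sup>2 \<le> 2 / y\<^sup>2" using y by (intro divide_left_mono power_mono) auto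
  also have "\<dots> \<le> 4 / y" using assms y by (simp add: field_simps power2_eq_square)
  finally have e: "2 / (y + real n)\<^sup>2 \<le> 4 / y" .
  have "\<bar>?a * ?h - 2 / (y + real n)\<^sup>2\<bar> \<le> \<bar>?a * ?h\<bar> + \<bar>2 / (y + real n)\<^sup>2\<bar>"
    by (rule abs_triangle_ineq4)
  also have "\<dots> = ?a * \<bar>?h\<bar> + 2 / (y + real n)\<^sup>2" using a0 by (simp add: abs_mult)
  also have "\<dots> \<le> 2 / y * (9 * real n + 2) + 4 / y"
    using a h e y by (intro add_mono mult_mono) auto
  also have "\<dots> = (18 * real n + 8) / y" using y by (simp add: field_simps)
  finally have b: "\<bar>?a * ?h - 2 / (y + real n)\<^sup>2\<bar> \<le> (18 * real n + 8) / y" .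
  have "\<bar>F' n y\<bar> = ?w * \<bar>?a * ?h - 2 / (y + real n)\<^sup>2\<bar>"
    using weight_nonneg[OF y] by (simp add: F'_def abs_mult)
  also have "\<dots> \<le> 1 / (3 ^ n * y) * ((18 * real n + 8) / y)"
    using weight_le[OF y] b y by (intro mult_mono) auto
  finally show ?thesis by (simp add: power2_eq_square field_simps)
qed

text \<open>For fixed \<open>n\<close> the weight is \<open>O(y\<^sup>-\<^sup>3)\<close> already because its Pochhammer symbol contains the
  three factors \<open>y (y+1) (y+2)\<close>, while the rational factors grow at most linearly.\<close>

lemma G'_tendsto_0: "(\<lambda>k. G' n (real k + 1 / 2)) \<longlonglongrightarrow> 0"
proof -
  define x where "x = real n"
  have x: "x \<ge> 0" by (simp add: x_def)
  define K where "K = (fact n * fact (2 * n) :: real)"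
  define M where "M = 3 * real n + 2 * real (3 * n + 3)"
  have lim0: "((\<lambda>y. R\<^sub>0 x y / y ^ 3) \<longlongrightarrow> 0) at_top"
    unfolding R\<^sub>0_def Q\<^sub>0_def by real_asymp
  have lim1: "((\<lambda>y. R\<^sub>1 x y / y ^ 3) \<longlongrightarrow> 0) at_top"
    unfolding R\<^sub>1_def Q\<^sub>0_def Q\<^sub>1_def by real_asymp
  have "((\<lambda>y. K * (\<bar>R\<^sub>0 x y / y ^ 3\<bar> * M + \<bar>R\<^sub>1 x y / y ^ 3\<bar>)) \<longlongrightarrow> K * (\<bar>0\<bar> * M + \<bar>0\<bar>)) at_top"
    by (intro tendsto_intros lim0 lim1)
  hence lim: "((\<lambda>y. K * (\<bar>R\<^sub>0 x y / y ^ 3\<bar> * M + \<bar>R\<^sub>1 x y / y ^ 3\<bar>)) \<longlongrightarrow> 0) at_top" by simp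
  have bound: "norm (G' n y) \<le> K * (\<bar>R\<^sub>0 x y / y ^ 3\<bar> * M + \<bar>R\<^sub>1 x y / y ^ 3\<bar>)" if y: "y \<ge> 1 / 2" for y
  proof -
    have y0: "y > 0" using y by simp
    have "pochhammer (y + 1) (3 * n + 2) \<ge> (y + 1) ^ 2"
    proof -
      have "(y + 1)\<^sup>2 * 1 \<le> ((y + 1) * (y + 2)) * pochhammer (y + 3) (3 * n)"
      proof (intro mult_mono)
        have "1 \<le> (fact (3 * n) :: real)" by simp
        also have "\<dots> \<le> pochhammer (y + 3) (3 * n)" using y0 by (intro pochhammer_ge_fact) simp
        finally show "1 \<le> pochhammer (y + 3) (3 * n)" .
      qed (use y0 in \<open>auto simp: power2_eq_square\<close>)
      also have "\<dots> = pochhammer (y + 1) (3 * n + 2)"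
        by (simp add: numeral_eq_Suc pochhammer_rec add_ac mult_ac)
      finally show ?thesis by simp
    qed
    moreover have "(y + 1)\<^sup>2 \<ge> y\<^sup>2" using y0 by (intro power_mono) auto
    ultimately have "y\<^sup>2 \<le> pochhammer (y + 1) (3 * n + 2)" by linarith
    hence "y * y\<^sup>2 \<le> y * pochhammer (y + 1) (3 * n + 2)" using y0 by (intro mult_left_mono) auto
    also have "\<dots> = pochhammer y (3 * n + 3)" by (simp add: numeral_eq_Suc pochhammer_rec)
    finally have p: "y ^ 3 \<le> pochhammer y (3 * n + 3)" by (simp add: power3_eq_cube power2_eq_square)
    have w: "weight n (3 * n + 3) y \<le> K / y ^ 3"
      unfolding weight_def K_def using p y0 by (intro divide_left_mono mult_pos_pos pochhammer_pos) auto
    have "\<bar>R\<^sub>0 x y * dlog_weight n (3 * n + 3) y + R\<^sub>1 x y\<bar>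
        \<le> \<bar>R\<^sub>0 x y\<bar> * \<bar>dlog_weight n (3 * n + 3) y\<bar> + \<bar>R\<^sub>1 x y\<bar>"
      using abs_triangle_ineq[of "R\<^sub>0 x y * dlog_weight n (3 * n + 3) y"] by (simp only: abs_mult)
    also have "\<dots> \<le> \<bar>R\<^sub>0 x y\<bar> * M + \<bar>R\<^sub>1 x y\<bar>"
      unfolding M_def by (intro add_mono mult_left_mono abs_dlog_weight_le[OF y]) auto
    finally have "norm (G' n y) \<le> K / y ^ 3 * (\<bar>R\<^sub>0 x y\<bar> * M + \<bar>R\<^sub>1 x y\<bar>)"
      unfolding G'_def x_def[symmetric] real_norm_def abs_mult
      using w weight_nonneg[OF y0, of n "3 * n + 3"] by (intro mult_mono) (auto simp: K_def)
    thus ?thesis using y0 by (simp add: abs_divide field_simps)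
  qed
  have "(G' n \<longlongrightarrow> 0) at_top"
    by (rule Lim_null_comparison[OF _ lim])
      (use eventually_ge_at_top[of "1 / 2 :: real"] bound in \<open>auto elim!: eventually_mono\<close>)
  moreover have "filterlim (\<lambda>k. real k + 1 / 2) at_top sequentially" by real_asymp
  ultimately show ?thesis by (rule filterlim_compose)
qed

section \<open>The alternating sum of reciprocal cubes\<close>

text \<open>The function \<open>\<Gamma>(t) \<Gamma>(1-t) sin(\<pi> t)\<close> is constant on the unit interval, so its
  derivative vanishes; dividing that derivative by \<open>\<Gamma>(x) \<Gamma>(1-x) sin(\<pi> x)\<close> gives the
  formula.\<close>

lemma Digamma_reflection:
  fixes x :: real
  assumes "0 < x" "x < 1"
  shows "Digamma x - Digamma (1 - x) = - pi * cot (pi * x)"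
proof -
  have sin_pos: "sin (pi * t) > 0" if "0 < t" "t < 1" for t
    using that by (intro sin_gt_zero) auto
  have refl: "Gamma t * Gamma (1 - t) * sin (pi * t) = pi" if "0 < t" "t < 1" for t :: real
  proof -
    have "Gamma (1 - complex_of_real t) = complex_of_real (Gamma (1 - t))"
      by (simp flip: Gamma_complex_of_real)
    moreover have "sin (complex_of_real pi * complex_of_real t) = complex_of_real (sin (pi * t))"
      by (simp flip: sin_of_real)
    ultimately have "complex_of_real (Gamma t * Gamma (1 - t)) = complex_of_real (pi / sin (pi * t))"
      using Gamma_reflection_complex[of "complex_of_real t"] by (simp add: Gamma_complex_of_real)
    hence "Gamma t * Gamma (1 - t) = pi / sin (pi * t)" by (simp only: of_real_eq_iff)
    thus ?thesis using sin_pos[OF that] by simp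
  qed
  have "((\<lambda>t. Gamma t * Gamma (1 - t) * sin (pi * t)) has_real_derivative
      Gamma x * Gamma (1 - x) * ((Digamma x - Digamma (1 - x)) * sin (pi * x) + pi * cos (pi * x))) (at x)"
    using assms by (auto intro!: derivative_eq_intros elim!: nonpos_Ints_cases simp: algebra_simps)
  moreover have "((\<lambda>t. Gamma t * Gamma (1 - t) * sin (pi * t)) has_real_derivative 0) (at x)"
  proof (rule has_field_derivative_transform_within_open[of "\<lambda>_. pi" _ _ "{0<..<1}"])
    show "pi = Gamma t * Gamma (1 - t) * sin (pi * t)" if "t \<in> {0<..<1}" for t
      using refl[of t] that by simp
  qed (use assms in auto)
  ultimately have
    "Gamma x * Gamma (1 - x) * ((Digamma x - Digamma (1 - x)) * sin (pi * x) + pi * cos (pi * x)) = 0"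
    by (rule DERIV_unique)
  moreover have "Gamma x > 0" "Gamma (1 - x) > 0" using assms by auto
  ultimately have "(Digamma x - Digamma (1 - x)) * sin (pi * x) + pi * cos (pi * x) = 0" by simp
  thus ?thesis using sin_pos[OF assms] by (simp add: cot_def field_simps)
qed

text \<open>The reflection formula for the Digamma function, differentiated twice.\<close>

lemma Polygamma_2_reflection:
  fixes x :: real
  assumes x: "0 < x" "x < 1"
  shows "Polygamma 2 x - Polygamma 2 (1 - x) = - 2 * pi ^ 3 * cos (pi * x) / sin (pi * x) ^ 3"
proof -
  have sin_pos: "sin (pi * t) > 0" if "0 < t" "t < 1" for t
    using that by (intro sin_gt_zero) auto
  have no_pole: "t \<notin> \<int>\<^sub>\<le>\<^sub>0" if "t > 0" for t :: real
    using that by (auto elim!: nonpos_Ints_cases)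
  have d1: "Polygamma 1 t + Polygamma 1 (1 - t) = (pi / sin (pi * t))\<^sup>2" if t: "0 < t" "t < 1" for t :: real
  proof -
    have "((\<lambda>t. Digamma t - Digamma (1 - t)) has_real_derivative
        Polygamma 1 t + Polygamma 1 (1 - t)) (at t)"
      using t by (auto intro!: derivative_eq_intros no_pole)
    moreover have *: "((\<lambda>t. - pi * cot (pi * t)) has_real_derivative (pi / sin (pi * t))\<^sup>2) (at t)"
    proof -
      have "((\<lambda>t. cot (pi * t)) has_real_derivative - inverse ((sin (pi * t))\<^sup>2) * pi) (at t)"
        using sin_pos[OF t]
        by (intro DERIV_chain2[OF DERIV_cot]) (auto intro!: derivative_eq_intros)
      from DERIV_cmult[OF this, of "- pi"] show ?thesis
        by (simp add: power2_eq_square field_simps)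
    qed
    from * have "((\<lambda>t. Digamma t - Digamma (1 - t)) has_real_derivative (pi / sin (pi * t))\<^sup>2) (at t)"
    proof (rule has_field_derivative_transform_within_open[of _ _ _ "{0<..<1}"])
      show "- pi * cot (pi * u) = Digamma u - Digamma (1 - u)" if "u \<in> {0<..<1}" for u
        using Digamma_reflection[of u] that by simp
    qed (use t in auto)
    ultimately show ?thesis by (rule DERIV_unique)
  qed
  have "((\<lambda>t. Polygamma 1 t + Polygamma 1 (1 - t)) has_real_derivative
      Polygamma 2 x - Polygamma 2 (1 - x)) (at x)"
    using x by (auto intro!: derivative_eq_intros no_pole simp: numeral_2_eq_2)
  moreover have "((\<lambda>t. (pi / sin (pi * t))\<^sup>2) has_real_derivative
      - 2 * pi ^ 3 * cos (pi * x) / sin (pi * x) ^ 3) (at x)"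
    using sin_pos[OF x]
    by (auto intro!: derivative_eq_intros simp: field_simps power2_eq_square power3_eq_cube)
  hence "((\<lambda>t. Polygamma 1 t + Polygamma 1 (1 - t)) has_real_derivative
      - 2 * pi ^ 3 * cos (pi * x) / sin (pi * x) ^ 3) (at x)"
  proof (rule has_field_derivative_transform_within_open[of _ _ _ "{0<..<1}"])
    show "(pi / sin (pi * u))\<^sup>2 = Polygamma 1 u + Polygamma 1 (1 - u)" if "u \<in> {0<..<1}" for u
      using d1[of u] that by simp
  qed (use x in auto)
  ultimately show ?thesis by (rule DERIV_unique)
qed

text \<open>Grouping consecutive terms turns the series into the difference of the series for
  \<open>Polygamma 2\<close> at \<open>1/4\<close> and \<open>3/4\<close>, which are exchanged by \<open>x \<mapsto> 1 - x\<close>.\<close>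

lemma alternating_cubes_sums: "(\<lambda>k. (-1) ^ k / (real k + 1 / 2) ^ 3) sums (pi ^ 3 / 4)"
proof -
  define f :: "nat \<Rightarrow> real" where "f = (\<lambda>k. (-1) ^ k / (real k + 1 / 2) ^ 3)"
  define g :: "nat \<Rightarrow> real"
    where "g = (\<lambda>k. (inverse ((1 / 4 + real k) ^ 3) - inverse ((3 / 4 + real k) ^ 3)) / 8)"
  have "norm (f k) = inverse ((1 / 2 + real k) ^ 3)" for k
    by (simp add: f_def norm_divide norm_power inverse_eq_divide add.commute)
  hence "summable (\<lambda>k. norm (f k))"
    using Polygamma_converges'[of "1 / 2 :: real" 3] by simp
  hence f: "f sums suminf f" by (rule summable_sums[OF summable_norm_cancel])
  hence "(\<lambda>k. sum f {k * 2..<k * 2 + 2}) sums suminf f" by (rule sums_group) simp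
  moreover have "sum f {k * 2..<k * 2 + 2} = g k" for k
  proof -
    have "{k * 2..<k * 2 + 2} = {2 * k, Suc (2 * k)}" by auto
    hence "sum f {k * 2..<k * 2 + 2}
        = 1 / (real (2 * k) + 1 / 2) ^ 3 - 1 / (real (Suc (2 * k)) + 1 / 2) ^ 3"
      by (simp add: f_def)
    moreover have "real (2 * k) + 1 / 2 = 2 * (1 / 4 + real k)"
      "real (Suc (2 * k)) + 1 / 2 = 2 * (3 / 4 + real k)" by simp_all
    moreover have "1 / (2 * u) ^ 3 - 1 / (2 * v) ^ 3 = (inverse (u ^ 3) - inverse (v ^ 3)) / 8"
      for u v :: real
      by (simp add: power_mult_distrib inverse_eq_divide diff_divide_distrib)
    ultimately show ?thesis by (simp only: g_def)
  qed
  ultimately have "g sums suminf f" by (simp only:)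
  moreover have "g sums (pi ^ 3 / 4)"
  proof -
    have cubes: "(\<lambda>k. inverse ((z + real k) ^ 3)) sums (- Polygamma 2 z / 2)" if "z \<noteq> 0" for z :: real
      using Polygamma_LIMSEQ[of z 2] that by simp
    have "g sums ((- Polygamma 2 (1 / 4) / 2 - - Polygamma 2 (3 / 4) / 2) / 8)"
      unfolding g_def by (intro sums_divide sums_diff cubes) simp_all
    moreover have "Polygamma 2 (1 / 4 :: real) - Polygamma 2 (3 / 4) = - 4 * pi ^ 3"
    proof -
      have "sin (pi * (1 / 4)) = sqrt 2 / 2" "cos (pi * (1 / 4)) = sqrt 2 / 2"
        by (simp_all add: sin_45 cos_45)
      moreover have "- 2 * pi ^ 3 * (sqrt 2 / 2) / (sqrt 2 / 2) ^ 3 = - 4 * pi ^ 3"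
        by (simp add: power3_eq_cube)
      moreover have "1 - 1 / 4 = (3 / 4 :: real)" by simp
      ultimately show ?thesis
        using Polygamma_2_reflection[of "1 / 4"] by (simp only:)
    qed
    hence "(- Polygamma 2 (1 / 4) / 2 - - Polygamma 2 (3 / 4) / 2) / 8 = pi ^ 3 / 4" by simp
    ultimately show ?thesis by (simp only:)
  qed
  ultimately have "suminf f = pi ^ 3 / 4" by (rule sums_unique2)
  with f show ?thesis by (simp only: f_def)
qed

section \<open>Double telescoping\<close>

text \<open>With \<open>T n = \<Sum>\<^sub>k (-1)\<^sup>k F' n (k + 1/2)\<close>, the sign turns the sum on the right of \<open>WZ_pair\<close>
  into a difference in \<open>k\<close>, so \<open>G' n (1/2) = T n - T (n + 1)\<close>. Hence the series equals
  \<open>T 0 = - 4 * (\<pi>\<^sup>3 / 4)\<close>.\<close>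

lemma G'_half_sums: "(\<lambda>n. G' n (1 / 2)) sums (- (pi ^ 3))"
proof -
  define a where "a = (\<lambda>n k. (-1) ^ k * F' n (real k + 1 / 2))"
  define T where "T = (\<lambda>n. \<Sum>k. a n k)"
  define C where "C = (\<lambda>n. (18 * real n + 8) / 3 ^ n)"
  define q where "q = (\<lambda>k. inverse ((real k + 1 / 2)\<^sup>2))"
  have q: "summable q"
    using Polygamma_converges'[of "1 / 2 :: real" 2] by (simp add: q_def add_ac)
  have bound: "norm (a n k) \<le> C n * q k" for n k
    using abs_F'_le[of "real k + 1 / 2" n] by (simp add: a_def C_def q_def abs_mult)
  have sm: "summable (a n)" for n
    by (rule summable_comparison_test'[OF summable_mult[OF q, of "C n"], of 0]) (rule bound)
  have T_le: "norm (T n) \<le> C n * suminf q" for n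
    unfolding T_def suminf_mult[OF q, symmetric]
    by (rule norm_suminf_le[OF _ summable_mult[OF q]]) (rule bound)
  have "C \<longlonglongrightarrow> 0" unfolding C_def by real_asymp
  hence "(\<lambda>n. C n * suminf q) \<longlonglongrightarrow> 0" by (rule tendsto_mult_left_zero)
  hence T_lim: "T \<longlonglongrightarrow> 0"
    by (rule Lim_null_comparison[rotated]) (intro always_eventually allI T_le)
  have step: "G' n (1 / 2) = T n - T (Suc n)" for n
  proof -
    define g where "g = (\<lambda>k. (-1) ^ k * G' n (real k + 1 / 2))"
    have "(\<lambda>k. norm (g k)) \<longlonglongrightarrow> 0"
      using tendsto_norm_zero[OF G'_tendsto_0[of n]] by (simp add: g_def abs_mult)
    hence "g \<longlonglongrightarrow> 0" by (rule tendsto_norm_zero_cancel)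
    hence "(\<lambda>k. g k - g (Suc k)) sums (g 0 - 0)" by (rule telescope_sums')
    moreover have "g k - g (Suc k) = a n k - a (Suc n) k" for k
      using WZ_pair[of "real k + 1 / 2" n] by (simp add: g_def a_def algebra_simps)
    ultimately have "(\<lambda>k. a n k - a (Suc n) k) sums g 0" by simp
    moreover have "(\<lambda>k. a n k - a (Suc n) k) sums (T n - T (Suc n))"
      unfolding T_def by (intro sums_diff summable_sums sm)
    ultimately show ?thesis by (auto simp: g_def dest: sums_unique2)
  qed
  have "(\<lambda>n. T n - T (Suc n)) sums (T 0 - 0)" using T_lim by (rule telescope_sums')
  moreover have "T 0 = - (pi ^ 3)"
  proof -
    have "F' 0 y = - 4 / y ^ 3" if "y > 0" for y
      using that
      by (simp add: F'_def weight_def dlog_weight_def harm_def field_simps power2_eq_square power3_eq_cube)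
    hence "a 0 k = - 4 * ((-1) ^ k / (real k + 1 / 2) ^ 3)" for k
      by (simp add: a_def)
    hence "a 0 = (\<lambda>k. - 4 * ((-1) ^ k / (real k + 1 / 2) ^ 3))" by blast
    hence "a 0 sums (- 4 * (pi ^ 3 / 4))"
      using sums_mult[OF alternating_cubes_sums, of "- 4"] by (simp only:)
    thus ?thesis unfolding T_def by (simp add: sums_iff)
  qed
  ultimately show ?thesis by (simp add: step)
qed

section \<open>Identification of the summand\<close>

lemma sum_odd_reciprocals: "(\<Sum>j<m. 1 / (1 / 2 + real j)) = 2 * harm (2 * m) - harm m"
proof (induction m)
  case (Suc m)
  have "harm (2 * Suc m) = harm (2 * m) + 1 / (2 * real m + 1) + 1 / (2 * real m + 2)"
    by (simp add: harm_Suc inverse_eq_divide add_ac)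
  moreover have "harm (Suc m) = harm m + 1 / (real m + 1)"
    by (simp add: harm_Suc inverse_eq_divide add_ac)
  moreover have "1 / (1 / 2 + real m) = 2 * (1 / (2 * real m + 1))"
    "2 * (1 / (2 * real m + 2)) = 1 / (real m + 1)"
    by (simp_all add: field_simps)
  moreover have "(\<Sum>j<Suc m. 1 / (1 / 2 + real j)) = 2 * harm (2 * m) - harm m + 1 / (1 / 2 + real m)"
    using Suc by simp
  ultimately show ?case by linarith
qed (simp add: harm_def)

text \<open>This shows that the factor \<open>64\<^sup>k\<close> of the series is what turns the two binomial coefficients into
  the Pochhammer symbol of the weight, by the duplication formula for \<open>(6k)!\<close>.\<close>

lemma binomial_product_eq:
  "real (3 * k choose k) * real (6 * k choose (3 * k))
     = 64 ^ k * pochhammer (1 / 2) (3 * k) / (fact k * fact (2 * k))"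
proof -
  have "real (3 * k choose k) = fact (3 * k) / (fact k * fact (2 * k))"
    by (subst binomial_fact) simp_all
  moreover have "real (6 * k choose (3 * k)) = fact (6 * k) / (fact (3 * k) * fact (3 * k))"
    by (subst binomial_fact) simp_all
  moreover have "fact (6 * k) = 64 ^ k * pochhammer (1 / 2) (3 * k) * (fact (3 * k) :: real)"
    using fact_double[of "3 * k", where ?'a = real] by (simp add: power_mult)
  ultimately show ?thesis by simp
qed

text \<open>At \<open>y = 1/2\<close> the sum over the Pochhammer factors runs over odd denominators, which accounts
  for the part \<open>2 H\<^bsub>6k-1\<^esub> - H\<^bsub>3k-1\<^esub>\<close> of \<open>calH k\<close> with \<open>k = n + 1\<close>: its last terms
  \<open>2 / (6n+6)\<close> and \<open>1 / (3n+3)\<close> cancel. The remaining rational term is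
  \<open>H\<^bsub>2n+1\<^esub> - H\<^bsub>2n\<^esub>\<close>.\<close>

lemma dlog_weight_half:
  "dlog_weight n (3 * n + 3) (1 / 2) = 1 / (2 * real n + 1) - calH (Suc n)"
proof -
  have "harm (6 * n + 6) = harm (6 * n + 5) + 1 / (6 * real n + 6)"
    by (simp add: numeral_eq_Suc harm_Suc inverse_eq_divide add_ac)
  moreover have "harm (3 * n + 3) = harm (3 * n + 2) + 1 / (3 * real n + 3)"
    by (simp add: numeral_eq_Suc harm_Suc inverse_eq_divide add_ac)
  moreover have "harm (2 * n + 1) = harm (2 * n) + 1 / (2 * real n + 1)"
    by (simp add: harm_Suc inverse_eq_divide add_ac)
  moreover have "calH (Suc n) = 2 * harm (6 * n + 5) - harm (3 * n + 2) + harm (2 * n + 1) - harm n"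
  proof -
    have "6 * Suc n - 1 = 6 * n + 5" "3 * Suc n - 1 = 3 * n + 2" "2 * Suc n - 1 = 2 * n + 1" by auto
    thus ?thesis unfolding calH_def by (simp only: diff_Suc_1)
  qed
  moreover have "dlog_weight n (3 * n + 3) (1 / 2)
      = harm n - harm (2 * n) - (2 * harm (6 * n + 6) - harm (3 * n + 3))"
  proof -
    have "2 * (3 * n + 3) = 6 * n + 6" by simp
    thus ?thesis unfolding dlog_weight_def sum_odd_reciprocals by (simp only:)
  qed
  moreover have "2 * (1 / (6 * real n + 6)) = 1 / (3 * real n + 3)" by (simp add: field_simps)
  ultimately show ?thesis by linarith
qed

theorem theorem1p19:
  shows "(\<lambda>n. let k = Suc n; x = real k in
           64 ^ k * ((368 * x ^ 3 - 396 * x ^ 2 + 116 * x - 9) * calH k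
                     + (240 * x ^ 3 - 252 * x ^ 2 + 12 * x + 11) / (2 * x - 1))
           / (x ^ 2 * (2 * x - 1) * (4 * x - 1) * (4 * x - 3)
              * real ((3 * k) choose k) * real ((6 * k) choose (3 * k))))
         sums (4 * pi ^ 3)"
proof -
  have "(let k = Suc n; x = real k in
           64 ^ k * ((368 * x ^ 3 - 396 * x ^ 2 + 116 * x - 9) * calH k
                     + (240 * x ^ 3 - 252 * x ^ 2 + 12 * x + 11) / (2 * x - 1))
           / (x ^ 2 * (2 * x - 1) * (4 * x - 1) * (4 * x - 3)
              * real ((3 * k) choose k) * real ((6 * k) choose (3 * k))))
        = - 4 * G' n (1 / 2)" for n
  proof -
    define k where "k = Suc n"
    define y where "y = real n"
    have y: "y \<ge> 0" by (simp add: y_def)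
    have pos: "2 * y + 1 > 0" "4 * y + 1 > 0" "4 * y + 3 > 0" "y + 1 > 0" using y by auto
    define W where "W = weight n (3 * n + 3) (1 / 2)"
    have fact_eq: "fact k * fact (2 * k) = 2 * (y + 1)\<^sup>2 * (2 * y + 1) * (fact n * fact (2 * n) :: real)"
    proof -
      have "fact k = (y + 1) * (fact n :: real)" by (simp add: k_def y_def algebra_simps)
      moreover have "fact (2 * k) = (2 * y + 2) * (2 * y + 1) * (fact (2 * n) :: real)"
        by (simp add: k_def y_def algebra_simps)
      ultimately show ?thesis by (simp add: power2_eq_square algebra_simps)
    qed
    have W: "64 ^ k / (real (3 * k choose k) * real (6 * k choose (3 * k)))
        = 2 * (y + 1)\<^sup>2 * (2 * y + 1) * W"
    proof -
      have "3 * k = 3 * n + 3" by (simp add: k_def)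
      thus ?thesis unfolding binomial_product_eq fact_eq W_def weight_def by simp
    qed
    \<comment> \<open>the two numerators of the series at \<open>x = y + 1\<close>, where
        \<open>2 x - 1 = 2 y + 1\<close>, \<open>4 x - 1 = 4 y + 3\<close> and \<open>4 x - 3 = 4 y + 1\<close>\<close>
    let ?P = "368 * (y + 1) ^ 3 - 396 * (y + 1)\<^sup>2 + 116 * (y + 1) - 9"
    let ?S = "240 * (y + 1) ^ 3 - 252 * (y + 1)\<^sup>2 + 12 * (y + 1) + 11"
    have "64 ^ k * (?P * calH k + ?S / (2 * y + 1))
          / ((y + 1)\<^sup>2 * (2 * y + 1) * (4 * y + 3) * (4 * y + 1)
              * real (3 * k choose k) * real (6 * k choose (3 * k)))
        = 64 ^ k / (real (3 * k choose k) * real (6 * k choose (3 * k)))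
          * ((?P * calH k + ?S / (2 * y + 1)) / ((y + 1)\<^sup>2 * (2 * y + 1) * (4 * y + 3) * (4 * y + 1)))"
      by (simp add: mult_ac)
    also have "\<dots> = W * (2 * (?P * calH k + ?S / (2 * y + 1)) / ((4 * y + 3) * (4 * y + 1)))"
      unfolding W using pos by (simp add: divide_simps)
    also have "2 * (?P * calH k + ?S / (2 * y + 1)) / ((4 * y + 3) * (4 * y + 1))
        = - 4 * (R\<^sub>0 y (1 / 2) * (1 / (2 * y + 1) - calH k) + R\<^sub>1 y (1 / 2))"
    proof -
      have "R\<^sub>0 y (1 / 2) = ?P / (2 * (4 * y + 3) * (4 * y + 1))"
        unfolding R\<^sub>0_def Q\<^sub>0_def using pos by (simp add: divide_simps) algebra
      \<comment> \<open>the \<open>?P\<close> in this numerator cancels the term \<open>1 / (2 * y + 1)\<close> of \<open>dlog_weight_half\<close>\<close>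
      moreover have "R\<^sub>1 y (1 / 2) = - (?P + ?S) / (2 * (2 * y + 1) * (4 * y + 3) * (4 * y + 1))"
        unfolding R\<^sub>1_def Q\<^sub>0_def Q\<^sub>1_def using pos by (simp add: divide_simps) algebra
      ultimately show ?thesis using pos by (simp add: divide_simps) algebra
    qed
    also have "W * (- 4 * (R\<^sub>0 y (1 / 2) * (1 / (2 * y + 1) - calH k) + R\<^sub>1 y (1 / 2)))
        = - 4 * G' n (1 / 2)"
      unfolding G'_def dlog_weight_half W_def k_def y_def by (rule mult.left_commute)
    finally show ?thesis
      by (simp add: Let_def k_def y_def algebra_simps)
  qed
  thus ?thesis using sums_mult[OF G'_half_sums, of "- 4"] by simp
qed

end
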